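(* Let $k\ge 2$ and $d\ge 1$ be integers, and let $t\ge 2$ be an integer relatively prime to $k$. There is a $d$-regular digraph, with every edge labelled by the constant $1\in\mathbb{Z}_k$, in which every zero-sum directed cycle has length at least $tk$, and which consequently satisfies the following: it contains at most $\lfloor d/k\rfloor$ pairwise vertex-disjoint zero-sum cycles and at most $\lfloor d^2/k\rfloor$ pairwise edge-disjoint zero-sum cycles; and if $d<k$, it has no zero-sum cycle.
   Context: All digraphs are finite, nonempty, simple and loopless: for each ordered pair $(u,v)$ there is at most one edge from $u$ to $v$, there are no edges from a vertex to itself, and both opposite edges $uv$ and $vu$ may be present. A digraph is $d$-regular if every vertex has outdegree $d$ and indegree $d$. A directed cycle $C=v_1v_2\cdots v_\ell v_1$ has distinct vertices $v_1,\dots,v_\ell$ and all displayed edges in the digraph (so $\ell\ge 2$); its length is $\ell$; cycles differing by cyclic rotation are the same. $\mathbb{Z}_k$ is the cyclic group of integers modulo $k$ under addition. For an edge-labelling by $\mathbb{Z}_k$, a directed cycle is zero-sum if the sum of its edge labels is $0$ in $\mathbb{Z}_k$. *)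

theory Defs
  imports "Graph_Theory.Pair_Digraph" "HOL-Algebra.Elementary_Groups"
begin

definition regular_digraph :: "nat \<Rightarrow> 'a pair_pre_digraph \<Rightarrow> bool" where
  "regular_digraph d G \<longleftrightarrow>
     (\<forall>v \<in> pverts G. out_degree (with_proj G) v = d \<and> in_degree (with_proj G) v = d)"

definition label_sum :: "nat \<Rightarrow> ('e \<Rightarrow> int) \<Rightarrow> 'e list \<Rightarrow> int" where
  "label_sum k w p = foldr (\<otimes>\<^bsub>integer_mod_group k\<^esub>) (map w p) \<one>\<^bsub>integer_mod_group k\<^esub>"

definition zero_sum_cycle ::
  "nat \<Rightarrow> ('a \<times> 'a \<Rightarrow> int) \<Rightarrow> 'a pair_pre_digraph \<Rightarrow> ('a \<times> 'a) list \<Rightarrow> bool" where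
  "zero_sum_cycle k w G p \<longleftrightarrow>
     pre_digraph.cycle (with_proj G) p \<and> label_sum k w p = \<one>\<^bsub>integer_mod_group k\<^esub>"

definition cycle_verts :: "('a \<times> 'a) list \<Rightarrow> 'a set" where
  "cycle_verts p = fst ` set p"

text \<open>A cycle is the list of its edges from a chosen starting vertex. Two rotations of one
  cycle have the same vertices and the same edges, so a family that is pairwise
  disjoint in either sense below contains at most one edge list for each cycle up to
  rotation, and its cardinality is the number of cycles.\<close>

definition vertex_disjoint_family :: "('a \<times> 'a) list set \<Rightarrow> bool" where
  "vertex_disjoint_family F \<longleftrightarrow> pairwise (\<lambda>p q. disjnt (cycle_verts p) (cycle_verts q)) F"

definition edge_disjoint_family :: "('a \<times> 'a) list set \<Rightarrow> bool" where
  "edge_disjoint_family F \<longleftrightarrow> pairwise (\<lambda>p q. disjnt (set p) (set q)) F"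

end

theory Submission
  imports Defs "HOL-Number_Theory.Cong"
begin

text \<open>
  Blow up the directed cycle on the residues modulo \<open>t\<close>, replacing each vertex by \<open>d\<close> copies and
  each edge by all \<open>d\<^sup>2\<close> edges between the copies. Every cycle has length divisible by \<open>t\<close>, and
  with constant label 1 a zero-sum cycle has length divisible by \<open>k\<close>, hence by \<open>t * k\<close>. As there
  are only \<open>t * d\<close> vertices and \<open>t * d\<^sup>2\<close> edges, the bounds follow by counting.
\<close>

text \<open>The copies of a residue are the numbers below \<open>t * d\<close> in its class modulo
  \<open>t\<close>, so vertices are plain naturals and adjacency is arithmetic.\<close>

definition cycle_blowup :: "nat \<Rightarrow> nat \<Rightarrow> nat pair_pre_digraph" where
  "cycle_blowup t d =
     \<lparr>pverts = {..<t * d},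
      parcs = (SIGMA u:{..<t * d}. {v. v < t * d \<and> v mod t = Suc u mod t})\<rparr>"

lemma card_residue_class_lessThan:
  fixes t d r :: nat
  assumes "r < t"
  shows "card {v. v < t * d \<and> v mod t = r} = d"
proof -
  have "{v. v < t * d \<and> v mod t = r} = (\<lambda>i. i * t + r) ` {..<d}"
  proof (intro equalityI subsetI)
    fix v assume v: "v \<in> {v. v < t * d \<and> v mod t = r}"
    then have "v = v div t * t + r" "v div t < d"
      by (auto simp: less_mult_imp_div_less mult.commute)
    then show "v \<in> (\<lambda>i. i * t + r) ` {..<d}" by blast
  next
    fix v assume "v \<in> (\<lambda>i. i * t + r) ` {..<d}"
    then obtain i where i: "v = i * t + r" "i < d" by auto
    have "i * t + r < Suc i * t" using assms by simp
    also have "\<dots> \<le> d * t" using i by (intro mult_right_mono) auto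
    finally show "v \<in> {v. v < t * d \<and> v mod t = r}"
      using i assms by (simp add: mult.commute)
  qed
  moreover have "inj_on (\<lambda>i. i * t + r) {..<d}"
    using assms by (auto simp: inj_on_def)
  ultimately show ?thesis by (simp add: card_image)
qed

text \<open>Adding \<open>t - 1\<close> undoes \<open>Suc\<close> modulo \<open>t\<close> within the
  naturals. With the edge condition solved for its tail, the in-neighbourhood of a vertex is again a
  single residue class.\<close>

lemma Suc_mod_eq_iff:
  fixes u v t :: nat
  assumes "0 < t"
  shows "v mod t = Suc u mod t \<longleftrightarrow> u mod t = (v + (t - 1)) mod t"
proof -
  have "v mod t = Suc u mod t \<longleftrightarrow> [v + (t - 1) = Suc u + (t - 1)] (mod t)"
    by (simp only: cong_add_rcancel_nat) (simp add: cong_def)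
  also have "Suc u + (t - 1) = u + t" using assms by simp
  finally show ?thesis by (auto simp: cong_def)
qed

lemma pair_digraph_cycle_blowup:
  assumes "2 \<le> t"
  shows "pair_digraph (cycle_blowup t d)"
proof -
  \<comment> \<open>This rules out loops. It fails for \<open>t = 1\<close>, where every residue is
    its own successor.\<close>
  have "v mod t \<noteq> Suc v mod t" for v
    using assms by (simp add: mod_Suc)
  then show ?thesis by unfold_locales (auto simp: cycle_blowup_def)
qed

lemma regular_cycle_blowup:
  assumes "0 < t"
  shows "regular_digraph d (cycle_blowup t d)"
proof -
  let ?G = "with_proj (cycle_blowup t d)"
  have "out_degree ?G v = d \<and> in_degree ?G v = d" if v: "v < t * d" for v
  proof
    have "out_arcs ?G v = Pair v ` {w. w < t * d \<and> w mod t = Suc v mod t}"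
      using v by (auto simp: out_arcs_def cycle_blowup_def)
    then show "out_degree ?G v = d"
      using assms by (simp add: out_degree_def card_image inj_on_def card_residue_class_lessThan)
    have "in_arcs ?G v = (\<lambda>u. (u, v)) ` {u. u < t * d \<and> u mod t = (v + (t - 1)) mod t}"
      using v assms by (auto simp: in_arcs_def cycle_blowup_def Suc_mod_eq_iff)
    then show "in_degree ?G v = d"
      using assms by (simp add: in_degree_def card_image inj_on_def card_residue_class_lessThan)
  qed
  then show ?thesis by (simp add: regular_digraph_def cycle_blowup_def)
qed

lemma card_parcs_cycle_blowup:
  assumes "0 < t"
  shows "card (parcs (cycle_blowup t d)) = t * d * d"
  using assms by (simp add: cycle_blowup_def card_residue_class_lessThan)

text \<open>Every edge advances the residue by one. For a closed walk, where \<open>u = v\<close>,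
  this forces \<open>t\<close> to divide the length.\<close>

lemma pcas_cycle_blowup_mod:
  assumes "pcas u p v" and "set p \<subseteq> parcs (cycle_blowup t d)"
  shows "v mod t = (u + length p) mod t"
  using assms
proof (induction p arbitrary: u)
  case (Cons e p)
  then have e: "fst e = u" "snd e mod t = Suc u mod t"
    by (auto simp: cycle_blowup_def)
  have "v mod t = (snd e + length p) mod t" using Cons by simp
  also have "\<dots> = (Suc u + length p) mod t" using e(2) by (metis mod_add_left_eq)
  finally show ?case by simp
qed simp

lemma label_sum_const_1: "label_sum k (\<lambda>e. 1) p = int (length p) mod int k"
  by (induction p) (simp_all add: label_sum_def mod_add_right_eq)

text \<open>This lets the length of a cycle count both its edges and its vertices, the latter as
  tails of edges.\<close>

lemma (in pair_wf_digraph) distinct_cycle: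
  assumes "cycle p"
  shows "distinct p" and "distinct (map fst p)"
proof -
  obtain u where u: "awalk u p u" "distinct (tl (pawalk_verts u p))" "p \<noteq> []"
    using assms by (auto simp: cycle_def)
  then show "distinct p" by (auto intro: distinct_tl_verts_imp_distinct)
  have *: "pawalk_verts x q = map fst q @ [y]" if "pcas x q y" for x y and q :: "('a \<times> 'a) list"
    using that by (induction q arbitrary: x) auto
  obtain e q where p: "p = e # q" using u(3) by (cases p) auto
  with u(1) have "fst e = u" "pcas (snd e) q u" by (auto simp: awalk_def)
  \<comment> \<open>\<open>cycle\<close> only makes the vertex list without its first entry
    distinct. That tail is \<open>map fst q @ [u]\<close>, a rotation of \<open>map fst p\<close>,
    which is \<open>u # map fst q\<close>.\<close>
  then show "distinct (map fst p)" using u(2) *[of "snd e" q u] by (simp add: p)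
qed

text \<open>Disjoint subsets of size at least \<open>m\<close> fill up \<open>A\<close>. The map
  \<open>f\<close> is the vertex set of a cycle in one use and the edge set in the other.\<close>

lemma disjoint_family_card_mult_le:
  assumes "finite A" and "0 < m"
    and sub: "\<And>p. p \<in> F \<Longrightarrow> f p \<subseteq> A"
    and card: "\<And>p. p \<in> F \<Longrightarrow> m \<le> card (f p)"
    and disj: "pairwise (\<lambda>p q. disjnt (f p) (f q)) F"
  shows "finite F" and "card F * m \<le> card A"
proof -
  \<comment> \<open>Finiteness of \<open>F\<close> must be derived before summing over it. Since
    \<open>m\<close> is positive, the sets are nonempty, so disjointness separates them and
    \<open>f\<close> embeds \<open>F\<close> into the finite power set of \<open>A\<close>.\<close>
  have "inj_on f F"
  proof (rule inj_onI, rule ccontr)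
    fix p q assume "p \<in> F" "q \<in> F" "f p = f q" "p \<noteq> q"
    then have "f p = {}" using disj by (auto simp: pairwise_def disjnt_def)
    with card[OF \<open>p \<in> F\<close>] \<open>0 < m\<close> show False by simp
  qed
  moreover have "finite (f ` F)"
    using sub \<open>finite A\<close> by (auto intro: finite_subset[of _ "Pow A"])
  ultimately show fin: "finite F" by (rule finite_imageD[rotated])
  have "card F * m = (\<Sum>p\<in>F. m)" by simp
  also have "\<dots> \<le> (\<Sum>p\<in>F. card (f p))" by (rule sum_mono) (rule card)
  also have "\<dots> = card (\<Union>p\<in>F. f p)"
    using fin disj finite_subset[OF sub \<open>finite A\<close>]
    by (intro card_UN_disjoint[symmetric]) (auto simp: pairwise_def disjnt_def)
  also have "\<dots> \<le> card A" using sub \<open>finite A\<close> by (intro card_mono) auto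
  finally show "card F * m \<le> card A" .
qed

lemma int_le_floor_divide:
  fixes n k :: nat and x :: real
  assumes "0 < k" and "real (n * k) \<le> x"
  shows "int n \<le> \<lfloor>x / real k\<rfloor>"
  using assms by (simp add: le_floor_iff pos_le_divide_eq)

theorem proposition6p1:
  fixes k d t :: nat
  assumes "k \<ge> 2" and "d \<ge> 1" and "t \<ge> 2" and "coprime t k"
  shows "\<exists>(G :: nat pair_pre_digraph) (w :: nat \<times> nat \<Rightarrow> int).
    pair_digraph G \<and> pverts G \<noteq> {} \<and> regular_digraph d G \<and>
    (\<forall>e \<in> parcs G. w e = 1) \<and>
    (\<forall>p. zero_sum_cycle k w G p \<longrightarrow> t * k \<le> length p) \<and>
    (\<forall>F. (\<forall>p \<in> F. zero_sum_cycle k w G p) \<and> vertex_disjoint_family F \<longrightarrow>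
       finite F \<and> int (card F) \<le> \<lfloor>real d / real k\<rfloor>) \<and>
    (\<forall>F. (\<forall>p \<in> F. zero_sum_cycle k w G p) \<and> edge_disjoint_family F \<longrightarrow>
       finite F \<and> int (card F) \<le> \<lfloor>(real d)\<^sup>2 / real k\<rfloor>) \<and>
    (d < k \<longrightarrow> \<not> (\<exists>p. zero_sum_cycle k w G p))"
proof -
  define G where "G = cycle_blowup t d"
  have t: "0 < t" using assms by simp
  interpret pair_digraph G
    unfolding G_def using assms(3) by (rule pair_digraph_cycle_blowup)
  let ?Z = "zero_sum_cycle k (\<lambda>e. 1) G"
  have length_ge: "t * k \<le> length p" if p: "?Z p" for p
  proof -
    obtain u where u: "awalk u p u" "p \<noteq> []"
      using p unfolding zero_sum_cycle_def cycle_def by blast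
    then have "pcas u p u" "set p \<subseteq> parcs (cycle_blowup t d)"
      by (auto simp: awalk_def simp flip: G_def)
    then have "u mod t = (u + length p) mod t" by (rule pcas_cycle_blowup_mod)
    \<comment> \<open>The summand 0 gives both sides the form that cancellation of \<open>u\<close>
      expects.\<close>
    then have "[u + 0 = u + length p] (mod t)" by (simp add: cong_def)
    then have "t dvd length p"
      by (simp only: cong_add_lcancel_nat) (simp add: cong_def mod_eq_0_iff_dvd)
    moreover have "int k dvd int (length p)"
      using that by (simp add: zero_sum_cycle_def label_sum_const_1 mod_eq_0_iff_dvd)
    \<comment> \<open>Coprimality of \<open>t\<close> and \<open>k\<close> combines the two
      divisibilities.\<close>
    ultimately have "t * k dvd length p"
      using assms(4) by (intro divides_mult) auto
    then show ?thesis using u(2) by (intro dvd_imp_le) auto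
  qed
  have arcs: "set p \<subseteq> parcs G" if "?Z p" for p
    using that by (auto simp: zero_sum_cycle_def cycle_def awalk_def)
  have verts: "cycle_verts p \<subseteq> pverts G" if "?Z p" for p
    using arcs[OF that] by (auto simp: cycle_verts_def intro: arc_fst_in_verts)
  have card_arcs: "t * k \<le> card (set p)" if "?Z p" for p
    using that length_ge[OF that] distinct_cycle(1)
    by (simp add: zero_sum_cycle_def distinct_card)
  have card_verts: "t * k \<le> card (cycle_verts p)" if "?Z p" for p
  proof -
    have "distinct (map fst p)" using that by (intro distinct_cycle) (simp add: zero_sum_cycle_def)
    then have "card (cycle_verts p) = length p"
      using distinct_card[of "map fst p"] by (simp add: cycle_verts_def)
    then show ?thesis using length_ge[OF that] by simp
  qed
  have pos: "0 < t * k" using assms by simp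
  have vertex_bound: "finite F \<and> int (card F) \<le> \<lfloor>real d / real k\<rfloor>"
    if F: "\<forall>p\<in>F. ?Z p" "vertex_disjoint_family F" for F
  proof -
    have "pairwise (\<lambda>p q. disjnt (cycle_verts p) (cycle_verts q)) F"
      using F(2) by (simp add: vertex_disjoint_family_def)
    note bound = disjoint_family_card_mult_le[OF pair_finite_verts pos _ _ this]
    have "card F * (t * k) \<le> t * d"
      using bound(2) F(1) verts card_verts by (simp add: G_def cycle_blowup_def)
    \<comment> \<open>The factor \<open>t\<close> occurs both in the size of the graph and in the
      minimal cycle length, so it cancels and the bound is independent of \<open>t\<close>.\<close>
    then have "card F * k \<le> d" using t by (simp add: mult.left_commute)
    then have "int (card F) \<le> \<lfloor>real d / real k\<rfloor>"
      using assms(1) by (intro int_le_floor_divide) (auto simp only: of_nat_le_iff)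
    then show ?thesis using bound(1) F(1) verts card_verts by blast
  qed
  have edge_bound: "finite F \<and> int (card F) \<le> \<lfloor>(real d)\<^sup>2 / real k\<rfloor>"
    if F: "\<forall>p\<in>F. ?Z p" "edge_disjoint_family F" for F
  proof -
    have "pairwise (\<lambda>p q. disjnt (set p) (set q)) F"
      using F(2) by (simp add: edge_disjoint_family_def)
    note bound = disjoint_family_card_mult_le[OF pair_finite_arcs pos _ _ this]
    have "card F * (t * k) \<le> t * d * d"
      using bound(2) F(1) arcs card_arcs t by (simp add: G_def card_parcs_cycle_blowup)
    then have "card F * k \<le> d\<^sup>2"
      using t by (simp add: mult.left_commute mult.assoc power2_eq_square)
    then have "real (card F * k) \<le> (real d)\<^sup>2"
      by (metis of_nat_le_iff of_nat_power)
    then have "int (card F) \<le> \<lfloor>(real d)\<^sup>2 / real k\<rfloor>"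
      using assms(1) by (intro int_le_floor_divide) auto
    then show ?thesis using bound(1) F(1) arcs card_arcs by blast
  qed
  have no_cycle: "\<not> (\<exists>p. ?Z p)" if "d < k"
  proof
    assume "\<exists>p. ?Z p"
    then obtain p where p: "?Z p" ..
    \<comment> \<open>A single zero-sum cycle would already need more distinct vertices than the
      \<open>t * d\<close> available.\<close>
    have "t * k \<le> card (pverts G)"
      using card_verts[OF p] card_mono[OF pair_finite_verts verts[OF p]] by simp
    then show False using that t by (simp add: G_def cycle_blowup_def)
  qed
  have "pverts G \<noteq> {}" using t assms(2) by (auto simp: G_def cycle_blowup_def lessThan_empty_iff)
  moreover have "regular_digraph d G"
    unfolding G_def using t by (rule regular_cycle_blowup)
  ultimately show ?thesis
    using pair_digraph_axioms length_ge vertex_bound edge_bound no_cycle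
    by (intro exI[of _ G] exI[of _ "\<lambda>e. 1"]) blast
qed

end
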